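(* Let $Y,S,U,\mathcal{E},C_{\mathcal{E}},A$ be as in the context. Assume that $$\mathbb{E}\exp(\lambda\|U\|_Y)<\infty\quad\text{for all }\lambda>0 .$$ Let $g:Y\to\mathbb{R}$ be a continuous function such that $|g(u)|\le a\exp(a\|u\|_Y)$ for all $u\in Y$, with some constant $a$. Let $T_n:Y\to Y$ ($n=1,2,\dots$) be linear projections and $P_k:S\to S$ ($k=1,2,\dots$) be bounded linear projections such that $\mathrm{Ran}(P_k)$ is a finite-dimensional subset of $S^1$, $\langle P_k\phi,\psi\rangle_Z=\langle\phi,P_k\psi\rangle_Z$ for all $\phi,\psi\in Z$, and $$\lim_{n\to\infty}\|T_ny-y\|_Y=0\ \ (y\in Y),\qquad \lim_{k\to\infty}\|P_kz-z\|_{S^1}=0\ \ (z\in \mathrm{Ran}(A)),\qquad \lim_{k\to\infty}\|P_kz-z\|_{S}=0\ \ (z\in S),$$ $$\|T_n\|_{L(Y)}\le C_0,\qquad \|P_k\|_{L(S^1)}\le C_0\qquad\text{for all }n,k,$$ with some $C_0>0$. Let $\omega_0\in\Omega$, let $u=U(\omega_0)$ and $\varepsilon=\mathcal{E}(\omega_0)$ be realizations of $U$ and $\mathcal{E}$, and put $$m=Au+\varepsilon,\qquad m_k=P_kAu+P_k\varepsilon .$$ Put $U_n=T_nU$. Then $$\lim_{n,k\to\infty}\mathcal{R}_{M_{kn}}(g(U_n)\,|\,m_k)=\mathcal{R}_M(g(U)\,|\,m).$$ Moreover, the limit $\lim_{n\to\infty}\mathcal{R}_{M_{kn}}(g(U_n)\,|\,m_k)$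 exists for each fixed $k$, and the limit $\lim_{k\to\infty}\mathcal{R}_{M_{kn}}(g(U_n)\,|\,m_k)$ exists for each fixed $n$.
   Context: Setting. $(\Omega,\Sigma,\mathbb{P})$ is a complete probability space, $Y$ is a separable Banach space and $U$ is a $Y$-valued random variable. $S$ is a separable Hilbert space and $\mathcal{E}$ is an $S$-valued Gaussian random variable, independent of $U$, with $\mathbb{E}\mathcal{E}=0$ and covariance operator $C_{\mathcal{E}}:S\to S$, i.e. $\mathbb{E}(\langle s_1,\mathcal{E}\rangle_S\langle\mathcal{E},s_2\rangle_S)=\langle s_1,C_{\mathcal{E}}s_2\rangle_S$. The essential range of $\mathcal{E}$ is dense in $S$, so $C_{\mathcal{E}}$ is one-to-one, self-adjoint, positive and trace class. For $t\ge 0$, $S^t:=C_{\mathcal{E}}^tS$ with norm $\|C_{\mathcal{E}}^tu\|_{S^t}:=\|u\|_S$, and $Z:=S^{1/2}$ (the Cameron–Martin space of $\mathcal{E}$) with $\langle z_1,z_2\rangle_Z=\langle C_{\mathcal{E}}^{-1/2}z_1,C_{\mathcal{E}}^{-1/2}z_2\rangle_S$. $A:Y\to S^1$ is a bounded linear operator. $L(X)$ denotes the bounded linear operators on $X$. Reconstructors. The reconstructor of the model $M=AU+\mathcal{E}$ at $m\in S$ is $$\mathcal{R}_M(g(U)\,|\,m)=\frac{\int_Y g(u)\exp\left(-\tfrac12\|Au\|_Z^2+\langle C_{\mathcal{E}}^{-1}Au,m\rangle_S\right)d\lambda(u)}{\int_Y \exp\left(-\tfrac12\|Au\|_Z^2+\langle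 C_{\mathcal{E}}^{-1}Au,m\rangle_S\right)d\lambda(u)},$$ where $\lambda$ is the distribution of $U$ in $Y$. For the model $M_{kn}=P_kAU_n+P_k\mathcal{E}$ with finite-dimensional noise, the same formula is used with $S$ replaced by $\mathrm{Ran}(P_k)$ (with the inner product inherited from $S$), $\mathcal{E}$ replaced by $P_k\mathcal{E}$, and its covariance operator $C_k$ on $\mathrm{Ran}(P_k)$: for $m_k\in\mathrm{Ran}(P_k)$, $$\mathcal{R}_{M_{kn}}(g(U_n)\,|\,m_k)=\frac{\int_Y g(v)\exp\left(-\tfrac12\|C_k^{-1/2}P_kAv\|_S^2+\langle C_k^{-1}P_kAv,m_k\rangle_S\right)d\lambda_n(v)}{\int_Y \exp\left(-\tfrac12\|C_k^{-1/2}P_kAv\|_S^2+\langle C_k^{-1}P_kAv,m_k\rangle_S\right)d\lambda_n(v)},$$ where $\lambda_n$ is the distribution of $U_n$ in $Y$. *)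

theory Defs
  imports "HOL-Probability.Probability"
begin

text \<open>
  Operators that live only on a linear subspace \<open>H\<close> of the ambient Hilbert space are total
  functions of which only the restriction to \<open>H\<close> matters; \<open>H = UNIV\<close> gives the ambient space.
  Their inverses are taken with \<^const>\<open>inv_into\<close> and are only applied to elements of the range.
\<close>

definition bounded_op_on :: "'s::real_inner set \<Rightarrow> ('s \<Rightarrow> 's) \<Rightarrow> bool" where
  "bounded_op_on H R \<longleftrightarrow>
     (\<forall>x\<in>H. R x \<in> H) \<and>
     (\<forall>x\<in>H. \<forall>y\<in>H. R (x + y) = R x + R y) \<and>
     (\<forall>c. \<forall>x\<in>H. R (c *\<^sub>R x) = c *\<^sub>R R x) \<and>
     (\<exists>B. \<forall>x\<in>H. norm (R x) \<le> B * norm x)"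

text \<open>
  The positive square root \<open>K\<^sup>1\<^sup>/\<^sup>2\<close> of a positive self-adjoint operator \<open>K\<close> on a complete
  subspace \<open>H\<close>. The four conditions determine it uniquely on \<open>H\<close>, so the choice operator
  only leaves its irrelevant values outside \<open>H\<close> open.
\<close>

definition sqrt_op_on :: "'s::real_inner set \<Rightarrow> ('s \<Rightarrow> 's) \<Rightarrow> 's \<Rightarrow> 's" where
  "sqrt_op_on H K = (SOME R. bounded_op_on H R \<and>
     (\<forall>x\<in>H. \<forall>y\<in>H. R x \<bullet> y = x \<bullet> R y) \<and>
     (\<forall>x\<in>H. 0 \<le> R x \<bullet> x) \<and>
     (\<forall>x\<in>H. R (R x) = K x))"

definition covariance_op_on ::
  "'w measure \<Rightarrow> 's::real_inner set \<Rightarrow> ('w \<Rightarrow> 's) \<Rightarrow> ('s \<Rightarrow> 's) \<Rightarrow> bool" where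
  "covariance_op_on M H X K \<longleftrightarrow> bounded_op_on H K \<and>
     (\<forall>s1\<in>H. \<forall>s2\<in>H.
        has_bochner_integral M (\<lambda>\<omega>. (s1 \<bullet> X \<omega>) * (X \<omega> \<bullet> s2)) (s1 \<bullet> K s2))"

text \<open>
  Gaussian in the usual sense: all one-dimensional marginals are normal, where a point mass
  counts as a normal law of variance zero.
\<close>

definition gaussian_rv :: "'w measure \<Rightarrow> ('w \<Rightarrow> 's::real_inner) \<Rightarrow> bool" where
  "gaussian_rv M X \<longleftrightarrow> X \<in> borel_measurable M \<and>
     (\<forall>s. \<exists>\<mu> \<sigma>.
        (0 < \<sigma> \<and> distributed M lborel (\<lambda>\<omega>. s \<bullet> X \<omega>) (normal_density \<mu> \<sigma>)) \<or>
        (AE \<omega> in M. s \<bullet> X \<omega> = \<mu>))"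

definition essential_range :: "'w measure \<Rightarrow> ('w \<Rightarrow> 's::topological_space) \<Rightarrow> 's set" where
  "essential_range M X =
     {s. \<forall>V. open V \<longrightarrow> s \<in> V \<longrightarrow> 0 < measure M {\<omega> \<in> space M. X \<omega> \<in> V}}"

text \<open>
  With \<open>C\<close> the (injective) covariance operator of the noise: \<open>S\<^sup>1 = C S\<close> with the norm
  transported by \<open>C\<close>, and the Cameron--Martin space \<open>Z = C\<^sup>1\<^sup>/\<^sup>2 S\<close> with its inner product.
\<close>

definition S1_space :: "('s::real_inner \<Rightarrow> 's) \<Rightarrow> 's set" where
  "S1_space C = range C"

definition S1_norm :: "('s::real_inner \<Rightarrow> 's) \<Rightarrow> 's \<Rightarrow> real" where
  "S1_norm C z = norm (inv C z)"

definition Z_space :: "('s::real_inner \<Rightarrow> 's) \<Rightarrow> 's set" where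
  "Z_space C = range (sqrt_op_on UNIV C)"

definition Z_inner :: "('s::real_inner \<Rightarrow> 's) \<Rightarrow> 's \<Rightarrow> 's \<Rightarrow> real" where
  "Z_inner C z1 z2 = inv (sqrt_op_on UNIV C) z1 \<bullet> inv (sqrt_op_on UNIV C) z2"

text \<open>
  The reconstructor of a model with noise in \<open>H\<close> having covariance operator \<open>K\<close> on \<open>H\<close>,
  forward map \<open>F\<close> with values in the range of \<open>K\<close>, and prior law \<open>\<nu>\<close>, at the data \<open>m \<in> H\<close>.
\<close>

definition recon_weight ::
  "'s::real_inner set \<Rightarrow> ('s \<Rightarrow> 's) \<Rightarrow> ('y \<Rightarrow> 's) \<Rightarrow> 's \<Rightarrow> 'y \<Rightarrow> real" where
  "recon_weight H K F m v =
     exp (- (1/2) * (norm (inv_into H (sqrt_op_on H K) (F v)))\<^sup>2 + inv_into H K (F v) \<bullet> m)"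

definition reconstructor ::
  "'s::real_inner set \<Rightarrow> ('s \<Rightarrow> 's) \<Rightarrow> ('y \<Rightarrow> 's) \<Rightarrow> 'y measure \<Rightarrow> ('y \<Rightarrow> real) \<Rightarrow> 's \<Rightarrow> real" where
  "reconstructor H K F \<nu> g m =
     (\<integral>v. g v * recon_weight H K F m v \<partial>\<nu>) / (\<integral>v. recon_weight H K F m v \<partial>\<nu>)"

end

theory Submission
  imports Defs
begin

text \<open>
  Write \<open>Q = P\<^sub>k\<close> and \<open>b = C\<^sup>-\<^sup>1 A v\<close>. Since \<open>Q\<close> is symmetric in the Cameron--Martin inner product,
  \<open>C\<^sup>-\<^sup>1 Q C\<close> is the adjoint \<open>Q\<^sup>*\<close> of \<open>Q\<close> in the noise space, so the covariance operator of \<open>Q \<E>\<close> is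
  \<open>Q C\<close> restricted to \<open>Ran Q\<close>. The element \<open>s \<in> Ran Q\<close> with \<open>Q C s = Q A v\<close> satisfies
  \<open>Q\<^sup>* s = Q\<^sup>* b\<close>, and the weight of the projected model becomes
  \<open>exp (- \<langle>b, Q A v\<rangle> / 2 + \<langle>b, Q m\<rangle>)\<close>, in which neither the inverse nor the square root of the
  projected covariance operator occurs. Here \<open>0 \<le> \<langle>b, Q A v\<rangle>\<close>, so the weights are dominated by
  \<open>exp (const * norm v)\<close>, and everything follows by dominated convergence on the probability space.
\<close>

subsection \<open>Square roots of positive operators\<close>

definition sqrt_coeff :: "nat \<Rightarrow> real" where
  "sqrt_coeff n = (1/2 gchoose n) * (- 1) ^ n"

lemma sqrt_coeff_0 [simp]: "sqrt_coeff 0 = 1"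
  by (simp add: sqrt_coeff_def)

lemma sqrt_coeff_Suc: "sqrt_coeff (Suc n) * real (Suc n) = sqrt_coeff n * (real n - 1/2)"
proof -
  have "sqrt_coeff (Suc n) * real (Suc n) = - ((- 1) ^ n * (real (Suc n) * (1/2 gchoose Suc n)))"
    by (simp add: sqrt_coeff_def)
  also have "real (Suc n) * (1/2 gchoose Suc n) = (1/2 - real n) * (1/2 gchoose n)"
    using gbinomial_mult_1[of "1/2::real" n] by (simp add: algebra_simps)
  finally show ?thesis
    by (simp add: sqrt_coeff_def algebra_simps)
qed

text \<open>By the recursion, consecutive coefficients from index 1 on have a nonnegative ratio, so
  the sign of the first one, \<open>- 1/2\<close>, persists.\<close>

lemma sqrt_coeff_nonpos: "sqrt_coeff (Suc n) \<le> 0"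
proof (induction n)
  case 0
  show ?case by (simp add: sqrt_coeff_def)
next
  case (Suc n)
  have "sqrt_coeff (Suc (Suc n)) = sqrt_coeff (Suc n) * ((real (Suc n) - 1/2) / real (Suc (Suc n)))"
    using sqrt_coeff_Suc[of "Suc n"] by (simp add: field_simps)
  also have "\<dots> \<le> 0"
    by (rule mult_nonpos_nonneg[OF Suc]) simp
  finally show ?case .
qed

text \<open>Partial sums are the coefficients of \<open>sqrt (1 - x) / (1 - x)\<close>, that is, of
  the power \<open>- 1/2\<close> of \<open>1 - x\<close>, and these are quotients of Pochhammer
  symbols by factorials. This gives both the summability of the series and the positivity of the
  operator root.\<close>

lemma sum_sqrt_coeff_nonneg: "0 \<le> (\<Sum>k\<le>n. sqrt_coeff k)"
proof -
  have "(\<Sum>k\<le>n. sqrt_coeff k) = (- 1) ^ n * (- (1/2) gchoose n)"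
    using gbinomial_sum_lower_neg[of "1/2::real" n] by (simp add: sqrt_coeff_def)
  also have "\<dots> = pochhammer (1/2) n / fact n"
    by (simp add: gbinomial_pochhammer flip: power_mult_distrib mult.assoc)
  also have "\<dots> \<ge> 0"
    by (intro divide_nonneg_nonneg pochhammer_nonneg) auto
  finally show ?thesis .
qed

text \<open>Only the coefficient 1 at index 0 is positive, so the absolute partial sums are 2 minus
  the signed ones and stay below 2. The series thus converges absolutely even at radius 1, which is
  what a mere contraction requires.\<close>

lemma summable_norm_sqrt_coeff: "(\<lambda>n. norm (sqrt_coeff n)) summable_on UNIV"
proof -
  have "(\<Sum>k\<le>n. norm (sqrt_coeff k)) = 2 - (\<Sum>k\<le>n. sqrt_coeff k)" for n
    by (induction n) (use sqrt_coeff_nonpos in \<open>auto simp: abs_if not_less antisym\<close>)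
  then have "(\<Sum>k\<le>n. norm (sqrt_coeff k)) \<le> 2" for n
    using sum_sqrt_coeff_nonneg[of n] by simp
  then have "summable (\<lambda>n. norm (sqrt_coeff n))"
    by (intro bounded_imp_summable[where B = 2]) auto
  then show ?thesis
    by (simp add: summable_on_UNIV_nonneg_real_iff)
qed

text \<open>Vandermonde's identity for the exponents 1/2 and 1/2: the Cauchy square of the series is
  \<open>1 - x\<close>.\<close>

lemma sqrt_coeff_convolution:
  "(\<Sum>k\<le>n. sqrt_coeff k * sqrt_coeff (n - k)) = (if n = 0 then 1 else if n = 1 then - 1 else 0)"
proof -
  have "(\<Sum>k\<le>n. sqrt_coeff k * sqrt_coeff (n - k))
      = (- 1) ^ n * (\<Sum>k\<le>n. (1/2 gchoose k) * (1/2 gchoose (n - k)))"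
    unfolding sum_distrib_left
  proof (rule sum.cong)
    fix k assume "k \<in> {..n}"
    then have "(- 1 :: real) ^ n = (- 1) ^ k * (- 1) ^ (n - k)"
      by (simp flip: power_add)
    then show "sqrt_coeff k * sqrt_coeff (n - k) = (- 1) ^ n * ((1/2 gchoose k) * (1/2 gchoose (n - k)))"
      by (simp add: sqrt_coeff_def)
  qed simp
  also have "(\<Sum>k\<le>n. (1/2 gchoose k) * (1/2 gchoose (n - k))) = ((1::real) gchoose n)"
    using gbinomial_Vandermonde[of "1/2::real" "1/2" n] by (simp add: atLeast0AtMost)
  also have "((1::real) gchoose n) = real (1 choose n)"
    using binomial_gbinomial[of 1 n, where 'a = real] by simp
  finally show ?thesis
    by (cases n) (auto simp: binomial_eq_0_iff)
qed

text \<open>On finite sums \<open>L\<close> commutes with summation, and the error of the image sum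
  is \<open>L\<close> applied to the error of the original sum, hence no larger. Only the behaviour
  of \<open>L\<close> on \<open>H\<close> enters, as suits operators that are meaningful on a
  subspace only.\<close>

lemma has_sum_nonexpansive_image:
  fixes f :: "'i \<Rightarrow> 'a::real_normed_vector" and L :: "'a \<Rightarrow> 'a"
  assumes f: "(f has_sum s) I" and H: "subspace H" "\<And>i. i \<in> I \<Longrightarrow> f i \<in> H" "s \<in> H"
    and add: "\<And>x y. x \<in> H \<Longrightarrow> y \<in> H \<Longrightarrow> L (x + y) = L x + L y"
    and scale: "\<And>c x. x \<in> H \<Longrightarrow> L (c *\<^sub>R x) = c *\<^sub>R L x"
    and le: "\<And>x. x \<in> H \<Longrightarrow> norm (L x) \<le> norm x"
  shows "((\<lambda>i. L (f i)) has_sum L s) I"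
proof -
  have L0: "L 0 = 0"
    using scale[OF H(3), of 0] by simp
  have sum_L: "sum f F \<in> H \<and> (\<Sum>i\<in>F. L (f i)) = L (sum f F)" if "finite F" "F \<subseteq> I" for F
    using that
    by (induction) (auto simp: L0 add H subspace_add subspace_0)
  have diff: "L x - L y = L (x - y)" if "x \<in> H" "y \<in> H" for x y
    using add[of x "- y"] scale[of y "- 1"] that subspace_neg[OF H(1)] by simp
  have f': "(sum f \<longlongrightarrow> s) (finite_subsets_at_top I)"
    using f by (simp add: has_sum_def)
  have "((\<lambda>F. (\<Sum>i\<in>F. L (f i)) - L s) \<longlongrightarrow> 0) (finite_subsets_at_top I)"
  proof (rule Lim_null_comparison)
    show "\<forall>\<^sub>F F in finite_subsets_at_top I. norm ((\<Sum>i\<in>F. L (f i)) - L s) \<le> norm (sum f F - s)"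
    proof (rule eventually_finite_subsets_at_top_weakI)
      fix F assume "finite F" "F \<subseteq> I"
      then show "norm ((\<Sum>i\<in>F. L (f i)) - L s) \<le> norm (sum f F - s)"
        using sum_L[of F] H by (simp add: diff le subspace_diff)
    qed
    show "((\<lambda>F. norm (sum f F - s)) \<longlongrightarrow> 0) (finite_subsets_at_top I)"
      using f' by (simp add: tendsto_norm_zero_iff LIM_zero_iff)
  qed
  then show ?thesis
    by (simp add: has_sum_def LIM_zero_iff)
qed

text \<open>
  With \<open>B = 1 - K\<close>, which is a contraction, the square root is the binomial series
  \<open>(1 - B)\<^sup>1\<^sup>/\<^sup>2 = (\<Sum>n. sqrt_coeff n * B\<^sup>n)\<close>.
\<close>

lemma sqrt_op_exists_contraction:
  fixes K :: "'s::{real_inner, banach} \<Rightarrow> 's"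
  assumes H: "subspace H" "closed H"
    and KH: "\<And>x. x \<in> H \<Longrightarrow> K x \<in> H"
    and K_add: "\<And>x y. x \<in> H \<Longrightarrow> y \<in> H \<Longrightarrow> K (x + y) = K x + K y"
    and K_scale: "\<And>c x. x \<in> H \<Longrightarrow> K (c *\<^sub>R x) = c *\<^sub>R K x"
    and K_le: "\<And>x. x \<in> H \<Longrightarrow> norm (K x) \<le> norm x"
    and K_sym: "\<And>x y. x \<in> H \<Longrightarrow> y \<in> H \<Longrightarrow> K x \<bullet> y = x \<bullet> K y"
    and K_pos: "\<And>x. x \<in> H \<Longrightarrow> 0 \<le> K x \<bullet> x"
  obtains R where "bounded_op_on H R" "\<And>x y. x \<in> H \<Longrightarrow> y \<in> H \<Longrightarrow> R x \<bullet> y = x \<bullet> R y"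
    "\<And>x. x \<in> H \<Longrightarrow> 0 \<le> R x \<bullet> x" "\<And>x. x \<in> H \<Longrightarrow> R (R x) = K x"
proof -
  define B where "B x = x - K x" for x
  have BH: "B x \<in> H" if "x \<in> H" for x
    using that H KH by (simp add: B_def subspace_diff)
  have B_le: "norm (B x) \<le> norm x" if x: "x \<in> H" for x
  proof -
    have xK: "x - K x \<in> H"
      using BH[OF x] by (simp add: B_def)
    have K_diff: "K (x - K x) = K x - K (K x)"
      using K_add[of x "- K x"] K_scale[of "K x" "- 1"] x KH[OF x] subspace_neg[OF H(1)]
      by simp
    \<comment> \<open>Positivity of \<open>K\<close> tested at \<open>x - K x\<close> gives \<open>0
      \<le> K x \<bullet> x - 2 * (K x \<bullet> K x) + K (K x) \<bullet> K x\<close>, and the last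
      term is at most \<open>K x \<bullet> K x\<close> because \<open>K\<close> is nonexpansive.
      Expanding the square of \<open>norm (x - K x)\<close> then yields the contraction
      bound.\<close>
    have 1: "K x \<bullet> K x \<le> K x \<bullet> x"
    proof -
      have "0 \<le> (K x - K (K x)) \<bullet> (x - K x)"
        using K_pos[OF xK] by (simp add: K_diff)
      moreover have "K (K x) \<bullet> x = K x \<bullet> K x"
        using K_sym[of "K x" x] x KH by simp
      moreover have "K (K x) \<bullet> K x \<le> K x \<bullet> K x"
      proof -
        have "K (K x) \<bullet> K x \<le> norm (K (K x)) * norm (K x)" by (rule norm_cauchy_schwarz)
        also have "\<dots> \<le> norm (K x) * norm (K x)"
          using K_le[of "K x"] KH[OF x] by (intro mult_right_mono) auto
        finally show ?thesis by (simp add: power2_norm_eq_inner flip: power2_eq_square)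
      qed
      ultimately show ?thesis by (simp add: algebra_simps)
    qed
    have "(norm (B x))\<^sup>2 = x \<bullet> x - 2 * (K x \<bullet> x) + K x \<bullet> K x"
      by (simp add: B_def power2_norm_eq_inner inner_commute algebra_simps)
    also have "\<dots> \<le> (norm x)\<^sup>2"
      using 1 K_pos[OF x] by (simp add: power2_norm_eq_inner)
    finally show ?thesis by (rule power2_le_imp_le) simp
  qed
  define p where "p n x = (B ^^ n) x" for n x
  have p_Suc: "p (Suc n) x = B (p n x)" and p_0: "p 0 x = x" for n x
    by (simp_all add: p_def)
  have pH: "p n x \<in> H" if "x \<in> H" for n x
    by (induction n) (auto simp: p_0 p_Suc that BH)
  have p_le: "norm (p n x) \<le> norm x" if "x \<in> H" for n x
    by (induction n) (auto simp: p_0 p_Suc intro: order_trans[OF B_le] pH that)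
  have p_add: "p n (x + y) = p n x + p n y" if "x \<in> H" "y \<in> H" for n x y
    by (induction n) (auto simp: p_0 p_Suc B_def K_add pH that)
  have p_scale: "p n (c *\<^sub>R x) = c *\<^sub>R p n x" if "x \<in> H" for n c x
    by (induction n) (auto simp: p_0 p_Suc B_def K_scale pH that scaleR_diff_right)
  have p_sym: "p n x \<bullet> y = x \<bullet> p n y" if "x \<in> H" "y \<in> H" for n x y
    using that
  proof (induction n arbitrary: x y)
    case (Suc n)
    have "p (Suc n) x \<bullet> y = p n x \<bullet> B y"
      using Suc.prems K_sym[of "p n x" y] pH
      by (simp add: p_Suc B_def inner_diff_left inner_diff_right)
    also have "\<dots> = x \<bullet> p n (B y)"
      using Suc BH by simp
    also have "p n (B y) = p (Suc n) y"
      by (simp add: p_def funpow_swap1)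
    finally show ?case .
  qed (simp add: p_0)
  have p_p: "p m (p n x) = p (m + n) x" for m n x
    by (simp add: p_def funpow_add)
  define R where "R x = (\<Sum>\<^sub>\<infinity>n. sqrt_coeff n *\<^sub>R p n x)" for x
  have R: "((\<lambda>n. sqrt_coeff n *\<^sub>R p n x) has_sum R x) UNIV" if "x \<in> H" for x
  proof -
    have "(\<lambda>n. norm (sqrt_coeff n *\<^sub>R p n x)) summable_on UNIV"
    proof (rule Infinite_Sum.abs_summable_on_comparison_test')
      show "(\<lambda>n. norm (sqrt_coeff n) * norm x) summable_on UNIV"
        by (rule summable_on_cmult_left) (rule summable_norm_sqrt_coeff)
    qed (use p_le[OF that] in \<open>auto intro: mult_left_mono\<close>)
    then show ?thesis
      unfolding R_def by (rule has_sum_infsum[OF Infinite_Sum.abs_summable_summable])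
  qed
  have RH: "R x \<in> H" if "x \<in> H" for x
  proof -
    have "(\<lambda>n. sqrt_coeff n *\<^sub>R p n x) sums R x"
      by (rule has_sum_imp_sums) (rule R[OF that])
    then have "(\<lambda>N. \<Sum>n<N. sqrt_coeff n *\<^sub>R p n x) \<longlonglongrightarrow> R x"
      by (simp add: sums_def)
    then show ?thesis
      by (rule closed_sequentially[OF H(2), rotated])
        (auto intro!: subspace_sum subspace_scale H pH that)
  qed
  have R_le: "norm (R x) \<le> (\<Sum>\<^sub>\<infinity>n. norm (sqrt_coeff n)) * norm x" if x: "x \<in> H" for x
  proof -
    have s: "(\<lambda>n. norm (sqrt_coeff n) * norm x) summable_on UNIV"
      by (rule summable_on_cmult_left) (rule summable_norm_sqrt_coeff)
    have n: "(\<lambda>n. norm (sqrt_coeff n *\<^sub>R p n x)) summable_on UNIV"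
      by (rule Infinite_Sum.abs_summable_on_comparison_test'[OF s]) (use p_le[OF x] in \<open>auto intro: mult_left_mono\<close>)
    have "norm (R x) \<le> (\<Sum>\<^sub>\<infinity>n. norm (sqrt_coeff n *\<^sub>R p n x))"
      unfolding R_def by (rule norm_infsum_bound) (rule n)
    also have "\<dots> \<le> (\<Sum>\<^sub>\<infinity>n. norm (sqrt_coeff n) * norm x)"
      by (rule infsum_mono[OF n s]) (use p_le[OF x] in \<open>auto intro: mult_left_mono\<close>)
    finally show ?thesis
      by (simp add: infsum_cmult_left')
  qed
  have R_add: "R (x + y) = R x + R y" if "x \<in> H" "y \<in> H" for x y
  proof (rule has_sum_unique[OF R])
    show "((\<lambda>n. sqrt_coeff n *\<^sub>R p n (x + y)) has_sum R x + R y) UNIV"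
      using has_sum_add[OF R[OF that(1)] R[OF that(2)]] by (simp add: p_add that scaleR_add_right)
  qed (use that H in \<open>auto intro: subspace_add\<close>)
  have R_scale: "R (c *\<^sub>R x) = c *\<^sub>R R x" if "x \<in> H" for c x
  proof (rule has_sum_unique[OF R])
    show "((\<lambda>n. sqrt_coeff n *\<^sub>R p n (c *\<^sub>R x)) has_sum c *\<^sub>R R x) UNIV"
      using has_sum_bounded_linear[OF bounded_linear_scaleR_right R[OF that], of c]
      by (simp add: p_scale that mult.commute o_def)
  qed (use that H in \<open>auto intro: subspace_scale\<close>)
  have R_inner: "((\<lambda>n. sqrt_coeff n * (p n x \<bullet> y)) has_sum R x \<bullet> y) UNIV" if "x \<in> H" for x y
    using has_sum_bounded_linear[OF bounded_linear_inner_left R[OF that], of y] by (simp add: o_def)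
  have R_sym: "R x \<bullet> y = x \<bullet> R y" if "x \<in> H" "y \<in> H" for x y
  proof (rule has_sum_unique[OF R_inner])
    show "((\<lambda>n. sqrt_coeff n * (p n x \<bullet> y)) has_sum x \<bullet> R y) UNIV"
      using R_inner[OF that(2), of x] by (simp only: p_sym[OF that] inner_commute[of _ x])
  qed (use that in auto)
  have R_pos: "0 \<le> R x \<bullet> x" if x: "x \<in> H" for x
  proof (rule LIMSEQ_le_const)
    have "(\<lambda>n. sqrt_coeff n * (p n x \<bullet> x)) sums (R x \<bullet> x)"
      by (rule has_sum_imp_sums) (rule R_inner[OF x])
    then show "(\<lambda>N. \<Sum>n\<le>N. sqrt_coeff n * (p n x \<bullet> x)) \<longlonglongrightarrow> R x \<bullet> x"
      by (simp add: sums_def_le)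
    have "0 \<le> (\<Sum>n\<le>N. sqrt_coeff n * (p n x \<bullet> x))" for N
    proof -
      \<comment> \<open>Replacing \<open>p n x \<bullet> x\<close> by its upper bound, the square of
        \<open>norm x\<close>, lowers every term with \<open>n > 0\<close>, where the coefficient is
        nonpositive, and leaves the term \<open>n = 0\<close> unchanged. What remains is a
        nonnegative partial sum of coefficients times that square.\<close>
      have "(\<Sum>n\<le>N. sqrt_coeff n * (norm x)\<^sup>2) \<le> (\<Sum>n\<le>N. sqrt_coeff n * (p n x \<bullet> x))"
      proof (rule sum_mono)
        fix n
        have "p n x \<bullet> x \<le> norm (p n x) * norm x" by (rule norm_cauchy_schwarz)
        also have "\<dots> \<le> (norm x)\<^sup>2"
          unfolding power2_eq_square by (rule mult_right_mono) (use p_le[OF x] in auto)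
        finally show "sqrt_coeff n * (norm x)\<^sup>2 \<le> sqrt_coeff n * (p n x \<bullet> x)"
          using sqrt_coeff_nonpos[of "n - 1"]
          by (cases n) (auto simp: p_0 power2_norm_eq_inner intro: mult_left_mono_neg)
      qed
      then show ?thesis
        using sum_sqrt_coeff_nonneg[of N]
        unfolding sum_distrib_right[symmetric]
        by (meson mult_nonneg_nonneg order_trans zero_le_power2)
    qed
    then show "\<exists>N. \<forall>n\<ge>N. 0 \<le> (\<Sum>n\<le>n. sqrt_coeff n * (p n x \<bullet> x))" by blast
  qed
  have R_R: "R (R x) = K x" if x: "x \<in> H" for x
  proof -
    \<comment> \<open>The double series of \<open>R (R x)\<close>. It is absolutely summable, so it
      may be summed in two ways: by rows, where each \<open>p i\<close> is pulled out of the inner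
      series and \<open>R (R x)\<close> results, and by antidiagonals.\<close>
    define f where "f = (\<lambda>(i, j). (sqrt_coeff i * sqrt_coeff j) *\<^sub>R p (i + j) x)"
    have "(\<lambda>ij. norm (f ij)) summable_on UNIV \<times> UNIV"
    proof (rule Infinite_Sum.abs_summable_on_comparison_test')
      have "(\<lambda>ij. norm (case ij of (i, j) \<Rightarrow> sqrt_coeff i * sqrt_coeff j)) summable_on UNIV \<times> UNIV"
        unfolding Infinite_Sum.abs_summable_on_Sigma_iff
        using summable_norm_sqrt_coeff
        by (auto simp: abs_mult infsum_cmult_right' intro!: summable_on_cmult_right summable_on_cmult_left)
      then show "(\<lambda>ij. norm (case ij of (i, j) \<Rightarrow> sqrt_coeff i * sqrt_coeff j) * norm x) summable_on UNIV \<times> UNIV"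
        by (rule summable_on_cmult_left)
      show "norm (f ij) \<le> norm (case ij of (i, j) \<Rightarrow> sqrt_coeff i * sqrt_coeff j) * norm x" for ij
        by (cases ij) (use p_le[OF x] in \<open>auto simp: f_def intro: mult_left_mono\<close>)
    qed
    then have "f summable_on UNIV \<times> UNIV" by (rule Infinite_Sum.abs_summable_summable)
    then obtain S where S: "(f has_sum S) (UNIV \<times> UNIV)"
      by (auto simp: summable_on_def)
    have "((\<lambda>i. sqrt_coeff i *\<^sub>R p i (R x)) has_sum S) UNIV"
    proof (rule has_sum_SigmaD[OF S])
      fix i
      have *: "((\<lambda>j. p i (sqrt_coeff j *\<^sub>R p j x)) has_sum p i (R x)) UNIV"
        by (rule has_sum_nonexpansive_image[OF R[OF x] H(1)])
          (auto intro: subspace_scale H pH x RH p_add p_scale p_le)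
      have "((\<lambda>j. sqrt_coeff i *\<^sub>R p i (sqrt_coeff j *\<^sub>R p j x)) has_sum sqrt_coeff i *\<^sub>R p i (R x)) UNIV"
        using has_sum_bounded_linear[OF bounded_linear_scaleR_right *, of "sqrt_coeff i"]
        by (simp add: o_def)
      then show "((\<lambda>j. f (i, j)) has_sum sqrt_coeff i *\<^sub>R p i (R x)) UNIV"
        by (simp add: f_def p_scale pH x p_p)
    qed
    then have 1: "S = R (R x)"
      using R[OF RH[OF x]] by (rule has_sum_unique)
    \<comment> \<open>Grouping by the total exponent \<open>n = i + j\<close>: the inner sums are
      the convolution coefficients, of which only those at 0 and 1 survive, leaving
      \<open>x - B x = K x\<close>.\<close>
    have "((\<lambda>(n, k). f (k, n - k)) has_sum S) (SIGMA n:UNIV. {..n})"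
      using S
      by (subst has_sum_reindex_bij_witness[where i = "\<lambda>(i, j). (i + j, i)" and j = "\<lambda>(n, k). (k, n - k)"
            and T = "UNIV \<times> UNIV" and h = f and s = S]) auto
    then have "((\<lambda>n. \<Sum>k\<le>n. f (k, n - k)) has_sum S) UNIV"
      by (rule has_sum_SigmaD) (auto intro: has_sum_finite)
    also have "(\<lambda>n. \<Sum>k\<le>n. f (k, n - k)) = (\<lambda>n. (if n = 0 then 1 else if n = 1 then - 1 else 0) *\<^sub>R p n x)"
      unfolding sqrt_coeff_convolution[symmetric] by (simp add: f_def scaleR_left.sum)
    finally have "((\<lambda>n. (if n = 0 then 1 else if n = 1 then - 1 else 0) *\<^sub>R p n x) has_sum S) UNIV" .
    moreover have "((\<lambda>n. (if n = 0 then 1 else if n = 1 then - 1 else 0) *\<^sub>R p n x) has_sum (x - B x)) UNIV"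
      by (rule has_sum_finite_neutralI[where B = "{0, 1}"]) (auto simp: p_0 p_Suc)
    ultimately have "S = x - B x" by (rule has_sum_unique)
    with 1 show ?thesis by (simp add: B_def)
  qed
  show thesis
  proof (rule that)
    show "bounded_op_on H R"
      unfolding bounded_op_on_def using RH R_add R_scale R_le by blast
  qed (fact R_sym R_pos R_R)+
qed

text \<open>Dividing by \<open>c = max b 1\<close> makes \<open>K\<close> nonexpansive, and the root
  of the quotient is multiplied by \<open>sqrt c\<close>. The maximum with 1 keeps \<open>c\<close>
  positive whatever the sign of the bound \<open>b\<close>.\<close>

lemma sqrt_op_exists:
  fixes K :: "'s::{real_inner, banach} \<Rightarrow> 's"
  assumes H: "subspace H" "closed H" and K: "bounded_op_on H K"
    and K_sym: "\<And>x y. x \<in> H \<Longrightarrow> y \<in> H \<Longrightarrow> K x \<bullet> y = x \<bullet> K y"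
    and K_pos: "\<And>x. x \<in> H \<Longrightarrow> 0 \<le> K x \<bullet> x"
  obtains R where "bounded_op_on H R" "\<And>x y. x \<in> H \<Longrightarrow> y \<in> H \<Longrightarrow> R x \<bullet> y = x \<bullet> R y"
    "\<And>x. x \<in> H \<Longrightarrow> 0 \<le> R x \<bullet> x" "\<And>x. x \<in> H \<Longrightarrow> R (R x) = K x"
proof -
  from K obtain b where b: "\<And>x. x \<in> H \<Longrightarrow> norm (K x) \<le> b * norm x"
    unfolding bounded_op_on_def by blast
  define c where "c = max b 1"
  have c: "0 < c" "b \<le> c" by (auto simp: c_def)
  define K' where "K' x = (1 / c) *\<^sub>R K x" for x
  have le: "norm (K' x) \<le> norm x" if "x \<in> H" for x
  proof -
    have "norm (K x) \<le> c * norm x"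
      using b[OF that] mult_right_mono[OF c(2), of "norm x"] by simp
    then show ?thesis
      using c by (simp add: K'_def field_simps)
  qed
  obtain R where R: "bounded_op_on H R" "\<And>x y. x \<in> H \<Longrightarrow> y \<in> H \<Longrightarrow> R x \<bullet> y = x \<bullet> R y"
    "\<And>x. x \<in> H \<Longrightarrow> 0 \<le> R x \<bullet> x" "\<And>x. x \<in> H \<Longrightarrow> R (R x) = K' x"
  proof (rule sqrt_op_exists_contraction[OF H])
    show "K' x \<in> H" if "x \<in> H" for x
      using K that H by (auto simp: K'_def bounded_op_on_def subspace_scale)
    show "K' (x + y) = K' x + K' y" if "x \<in> H" "y \<in> H" for x y
      using K that by (auto simp: K'_def bounded_op_on_def scaleR_add_right)
    show "K' (r *\<^sub>R x) = r *\<^sub>R K' x" if "x \<in> H" for r x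
      using K that by (auto simp: K'_def bounded_op_on_def)
    show "K' x \<bullet> y = x \<bullet> K' y" if "x \<in> H" "y \<in> H" for x y
      using K_sym[OF that] by (simp add: K'_def)
    show "0 \<le> K' x \<bullet> x" if "x \<in> H" for x
      using K_pos[OF that] c by (simp add: K'_def)
  qed (use le in blast)+
  from R(1) obtain b' where b': "\<And>x. x \<in> H \<Longrightarrow> norm (R x) \<le> b' * norm x"
    unfolding bounded_op_on_def by blast
  show thesis
  proof (rule that[of "\<lambda>x. sqrt c *\<^sub>R R x"])
    have "norm (sqrt c *\<^sub>R R x) \<le> (sqrt c * b') * norm x" if "x \<in> H" for x
      using mult_left_mono[OF b'[OF that], of "sqrt c"] c by (simp add: mult.assoc)
    then show "bounded_op_on H (\<lambda>x. sqrt c *\<^sub>R R x)"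
      using R(1) H(1) unfolding bounded_op_on_def
      by (intro conjI exI[of _ "sqrt c * b'"]) (auto simp: subspace_scale scaleR_add_right mult.commute)
    show "sqrt c *\<^sub>R R (sqrt c *\<^sub>R R x) = K x" if "x \<in> H" for x
      using R(1,4) that c by (simp add: bounded_op_on_def K'_def)
  qed (use R c in auto)
qed

text \<open>Since a root exists, the choice operator in \<open>sqrt_op_on\<close> picks an operator
  with the defining properties.\<close>

lemma sqrt_op_on:
  fixes K :: "'s::{real_inner, banach} \<Rightarrow> 's"
  assumes "subspace H" "closed H" "bounded_op_on H K"
    and "\<And>x y. x \<in> H \<Longrightarrow> y \<in> H \<Longrightarrow> K x \<bullet> y = x \<bullet> K y"
    and "\<And>x. x \<in> H \<Longrightarrow> 0 \<le> K x \<bullet> x"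
  shows "\<And>x. x \<in> H \<Longrightarrow> sqrt_op_on H K x \<in> H"
    and "\<And>x y. x \<in> H \<Longrightarrow> y \<in> H \<Longrightarrow> sqrt_op_on H K x \<bullet> y = x \<bullet> sqrt_op_on H K y"
    and "\<And>x. x \<in> H \<Longrightarrow> sqrt_op_on H K (sqrt_op_on H K x) = K x"
proof -
  define Q where "Q = (\<lambda>R. bounded_op_on H R \<and> (\<forall>x\<in>H. \<forall>y\<in>H. R x \<bullet> y = x \<bullet> R y) \<and>
     (\<forall>x\<in>H. 0 \<le> R x \<bullet> x) \<and> (\<forall>x\<in>H. R (R x) = K x))"
  have "\<exists>R. Q R"
    using sqrt_op_exists[OF assms] unfolding Q_def by metis
  then have "Q (sqrt_op_on H K)"
    unfolding sqrt_op_on_def Q_def[symmetric] by (rule someI_ex)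
  then show "\<And>x. x \<in> H \<Longrightarrow> sqrt_op_on H K x \<in> H"
    and "\<And>x y. x \<in> H \<Longrightarrow> y \<in> H \<Longrightarrow> sqrt_op_on H K x \<bullet> y = x \<bullet> sqrt_op_on H K y"
    and "\<And>x. x \<in> H \<Longrightarrow> sqrt_op_on H K (sqrt_op_on H K x) = K x"
    by (auto simp: Q_def bounded_op_on_def)
qed

subsection \<open>Covariance operators\<close>

text \<open>With \<open>J\<close> the root of \<open>K\<close>, \<open>F v = J (J s)\<close>, so
  \<open>J s\<close> is the preimage of \<open>F v\<close> under \<open>J\<close>, and its squared
  norm is \<open>s \<bullet> K s\<close>. The root disappears from the weight. Injectivity of
  \<open>J\<close> is inherited from \<open>K\<close>.\<close>

lemma recon_weight_eq:
  fixes K :: "'s::{real_inner, banach} \<Rightarrow> 's"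
  assumes K: "subspace H" "closed H" "bounded_op_on H K"
    "\<And>x y. x \<in> H \<Longrightarrow> y \<in> H \<Longrightarrow> K x \<bullet> y = x \<bullet> K y"
    "\<And>x. x \<in> H \<Longrightarrow> 0 \<le> K x \<bullet> x"
    and inj: "inj_on K H" and s: "s \<in> H" "K s = F v"
  shows "recon_weight H K F m v = exp (- (1/2) * (s \<bullet> F v) + s \<bullet> m)"
proof -
  let ?J = "sqrt_op_on H K"
  have J: "?J x \<in> H" "?J x \<bullet> y = x \<bullet> ?J y" "?J (?J x) = K x" if "x \<in> H" "y \<in> H" for x y
    using sqrt_op_on[of H K] K that by blast+
  have "inj_on ?J H"
    by (rule inj_onI) (metis J(3) inj inj_onD)
  then have "inv_into H ?J (?J (?J s)) = ?J s"
    by (rule inv_into_f_f) (rule J(1)[OF s(1) s(1)])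
  then have "(norm (inv_into H ?J (F v)))\<^sup>2 = ?J s \<bullet> ?J s"
    using J(3)[OF s(1) s(1)] s(2) by (simp add: power2_norm_eq_inner)
  also have "\<dots> = s \<bullet> F v"
    using J(2)[OF s(1) J(1)[OF s(1) s(1)]] J(3)[OF s(1) s(1)] s(2) by simp
  finally have "(norm (inv_into H ?J (F v)))\<^sup>2 = s \<bullet> F v" .
  moreover have "inv_into H K (F v) = s"
    using inv_into_f_f[OF inj s(1)] s(2) by simp
  ultimately show ?thesis
    by (simp add: recon_weight_def)
qed

section \<open>Symmetry, positivity and injectivity of covariance operators\<close>

lemma covariance_op_on_sym:
  assumes "covariance_op_on M H X K" "x \<in> H" "y \<in> H"
  shows "K x \<bullet> y = x \<bullet> K y"
proof -
  have "has_bochner_integral M (\<lambda>\<omega>. (x \<bullet> X \<omega>) * (X \<omega> \<bullet> y)) (x \<bullet> K y)"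
    "has_bochner_integral M (\<lambda>\<omega>. (x \<bullet> X \<omega>) * (X \<omega> \<bullet> y)) (y \<bullet> K x)"
    using assms by (auto simp: covariance_op_on_def inner_commute mult.commute)
  then show ?thesis
    using has_bochner_integral_eq by (metis inner_commute)
qed

lemma covariance_op_on_pos:
  assumes "covariance_op_on M H X K" "x \<in> H"
  shows "0 \<le> K x \<bullet> x"
proof -
  have "has_bochner_integral M (\<lambda>\<omega>. (x \<bullet> X \<omega>) * (X \<omega> \<bullet> x)) (x \<bullet> K x)"
    using assms by (auto simp: covariance_op_on_def)
  then have "x \<bullet> K x = (\<integral>\<omega>. (x \<bullet> X \<omega>) * (X \<omega> \<bullet> x) \<partial>M)"
    by (simp add: has_bochner_integral_integral_eq)
  also have "\<dots> \<ge> 0"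
    by (rule Bochner_Integration.integral_nonneg) (simp add: inner_commute)
  finally show ?thesis by (simp add: inner_commute)
qed

text \<open>If \<open>C s = 0\<close>, the second moment of \<open>s \<bullet> X\<close> vanishes,
  so the open half-space \<open>V\<close> of points with positive inner product with
  \<open>s\<close> has probability zero. For \<open>s \<noteq> 0\<close> it contains
  \<open>s\<close>, hence meets the dense essential range and has positive probability, a
  contradiction.\<close>

lemma covariance_op_inj:
  fixes X :: "'w \<Rightarrow> 's::real_inner"
  assumes cov: "covariance_op_on M UNIV X C" and meas: "X \<in> borel_measurable M"
    and dense: "closure (essential_range M X) = UNIV" and "finite_measure M"
  shows "inj C"
proof -
  interpret finite_measure M by fact
  have zero: "s = 0" if s: "C s = 0" for s
  proof (rule ccontr)
    assume "s \<noteq> 0"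
    have meas_s: "(\<lambda>\<omega>. s \<bullet> X \<omega>) \<in> borel_measurable M"
      by (rule measurable_compose[OF meas])
        (auto intro!: borel_measurable_continuous_onI continuous_intros)
    have "has_bochner_integral M (\<lambda>\<omega>. (s \<bullet> X \<omega>) * (X \<omega> \<bullet> s)) (s \<bullet> C s)"
      using cov by (auto simp: covariance_op_on_def)
    then have "has_bochner_integral M (\<lambda>\<omega>. (s \<bullet> X \<omega>)\<^sup>2) 0"
      using s by (simp add: inner_commute power2_eq_square)
    then have "integrable M (\<lambda>\<omega>. (s \<bullet> X \<omega>)\<^sup>2)" "(\<integral>\<omega>. (s \<bullet> X \<omega>)\<^sup>2 \<partial>M) = 0"
      by (simp_all add: has_bochner_integral_iff)
    then have "AE \<omega> in M. (s \<bullet> X \<omega>)\<^sup>2 = 0"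
      by (simp add: integral_nonneg_eq_0_iff_AE)
    then have ae: "AE \<omega> in M. \<not> 0 < s \<bullet> X \<omega>"
      by eventually_elim auto
    define V where "V = {x. 0 < s \<bullet> x}"
    have V: "open V"
      unfolding V_def by (intro open_Collect_less continuous_intros)
    have "s \<in> V" using \<open>s \<noteq> 0\<close> by (simp add: V_def)
    then have "V \<inter> essential_range M X \<noteq> {}"
      using open_Int_closure_eq_empty[OF V, of "essential_range M X"] dense by auto
    then have "0 < measure M {\<omega> \<in> space M. X \<omega> \<in> V}"
      using V by (auto simp: essential_range_def)
    moreover have "measure M {\<omega> \<in> space M. X \<omega> \<in> V} = 0"
    proof -
      have "{\<omega> \<in> space M. X \<omega> \<in> V} \<in> sets M"
        using meas_s unfolding V_def by simp
      then have "emeasure M {\<omega> \<in> space M. X \<omega> \<in> V} = 0"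
        using ae by (subst (asm) AE_iff_measurable[where N = "{\<omega> \<in> space M. X \<omega> \<in> V}"]) (auto simp: V_def)
      then show ?thesis by (simp add: measure_def)
    qed
    ultimately show False by simp
  qed
  show ?thesis
  proof (rule injI)
    fix x y assume eq: "C x = C y"
    have "C (x + (- 1) *\<^sub>R y) = C x + C ((- 1) *\<^sub>R y)"
      using cov unfolding covariance_op_on_def bounded_op_on_def by blast
    also have "\<dots> = C x + (- 1) *\<^sub>R C y"
      using cov unfolding covariance_op_on_def bounded_op_on_def by (metis UNIV_I)
    finally have "C (x + (- 1) *\<^sub>R y) = 0" using eq by simp
    then have "x + (- 1) *\<^sub>R y = 0" by (rule zero)
    then show "x = y" by simp
  qed
qed

text \<open>For \<open>y\<close> in \<open>range C\<close> the Cameron-Martin product of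
  \<open>C x\<close> and \<open>y\<close> is just \<open>x \<bullet> y\<close>. Symmetry of
  \<open>Q\<close> in that product therefore becomes the adjoint relation for \<open>y\<close> in
  \<open>range C\<close>, and density with continuity extends it to all \<open>y\<close>.\<close>

lemma Z_symmetric_adjoint:
  fixes C Q :: "'s::{real_inner, banach} \<Rightarrow> 's"
  assumes C: "bounded_op_on UNIV C" "\<And>x y. C x \<bullet> y = x \<bullet> C y" "\<And>x. 0 \<le> C x \<bullet> x" "inj C"
    and dense: "closure (range C) = UNIV"
    and Q: "bounded_linear Q" "range Q \<subseteq> range C"
    and sym: "\<forall>\<phi>\<in>Z_space C. \<forall>\<psi>\<in>Z_space C. Z_inner C (Q \<phi>) \<psi> = Z_inner C \<phi> (Q \<psi>)"
  shows "inv C (Q (C x)) \<bullet> y = x \<bullet> Q y"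
proof -
  let ?J = "sqrt_op_on UNIV C"
  have J: "?J x \<bullet> y = x \<bullet> ?J y" "?J (?J x) = C x" for x y
    using sqrt_op_on[of UNIV C] C(1-3) by auto
  have injJ: "inj ?J"
    by (rule injI) (metis J(2) C(4) injD)
  have Z: "Z_inner C (C x) (?J w) = x \<bullet> ?J w" for x w
    by (simp add: Z_inner_def inv_f_f[OF injJ] J(1) flip: J(2))
  have mem: "C x \<in> Z_space C" for x
    by (simp add: Z_space_def flip: J(2))
  define d where "d = inv C (Q (C x))"
  have d: "C d = Q (C x)"
    unfolding d_def by (rule f_inv_into_f) (use Q in blast)
  have eq: "d \<bullet> y = x \<bullet> Q y" if "y \<in> range C" for y
  proof -
    from that obtain z where z: "y = C z" by blast
    obtain z' where z': "Q y = C z'" using Q(2) by blast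
    have "d \<bullet> y = Z_inner C (Q (C x)) y"
      using Z[of d "?J z"] by (simp add: J(2) z d)
    also have "\<dots> = Z_inner C (C x) (Q y)"
      using sym mem that by blast
    also have "\<dots> = x \<bullet> Q y"
      using Z[of x "?J z'"] by (simp add: J(2) z')
    finally show ?thesis .
  qed
  have "closed {y. d \<bullet> y = x \<bullet> Q y}"
    by (intro closed_Collect_eq continuous_intros bounded_linear.continuous_on[OF Q(1)])
  then have "closure (range C) \<subseteq> {y. d \<bullet> y = x \<bullet> Q y}"
    by (intro closure_minimal) (use eq in auto)
  then show ?thesis
    using dense unfolding d_def by auto
qed

text \<open>A dimension count inside a possibly infinite-dimensional space: a basis \<open>b\<close>
  of the span is mapped to an independent set of the same size. A basis vector outside the span of
  the image could be added to it, giving an independent set larger than \<open>b\<close>.\<close>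

lemma linear_inj_on_span_surj:
  fixes f :: "'a::real_vector \<Rightarrow> 'a"
  assumes "linear f" "finite B" "f ` span B \<subseteq> span B" "inj_on f (span B)"
  shows "f ` span B = span B"
proof -
  obtain b where b: "b \<subseteq> B" "independent b" "B \<subseteq> span b"
    using maximal_independent_subset[of B] by blast
  then have span: "span b = span B"
    by (intro subset_antisym span_mono span_minimal) auto
  have fin: "finite b" using b(1) assms(2) by (rule finite_subset)
  have ind: "independent (f ` b)"
    using assms(1,4) b(2) by (intro linear_independent_injective_image) (auto simp: span)
  have sub: "f ` b \<subseteq> span b"
    using assms(3) span_superset[of b] unfolding span by blast
  have "inj_on f b"
    using assms(4) span_superset[of b] unfolding span by (rule inj_on_subset)
  then have card: "card (f ` b) = card b" by (rule card_image)
  have "b \<subseteq> span (f ` b)"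
  proof
    fix x assume x: "x \<in> b"
    show "x \<in> span (f ` b)"
    proof (rule ccontr)
      assume nx: "x \<notin> span (f ` b)"
      then have "independent (insert x (f ` b))"
        using ind by (simp add: independent_insertI)
      moreover have "insert x (f ` b) \<subseteq> span b"
        using sub x span_superset by auto
      ultimately have "card (insert x (f ` b)) \<le> card b"
        using independent_span_bound[OF fin] by blast
      moreover have "x \<notin> f ` b" using nx span_base[of x "f ` b"] by blast
      ultimately show False using fin card by simp
    qed
  qed
  then have "span b \<subseteq> span (f ` b)"
    by (rule span_minimal) simp
  then show ?thesis
    using assms(3) linear_span_image[OF assms(1), of b] span by (metis subset_antisym)
qed

lemma projected_recon_weight:
  fixes C K Q :: "'s::{real_inner, banach} \<Rightarrow> 's"
  assumes cov: "covariance_op_on M UNIV X C" and injC: "inj C" and dense: "closure (range C) = UNIV"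
    and Q: "bounded_linear Q" "Q \<circ> Q = Q" "finite B" "range Q = span B" "range Q \<subseteq> range C"
    and sym: "\<forall>\<phi>\<in>Z_space C. \<forall>\<psi>\<in>Z_space C. Z_inner C (Q \<phi>) \<psi> = Z_inner C \<phi> (Q \<psi>)"
    and covK: "covariance_op_on M (range Q) (\<lambda>\<omega>. Q (X \<omega>)) K"
    and F: "F v = Q (C b)"
  shows "recon_weight (range Q) K F (Q m) v = exp (- (1/2) * (b \<bullet> Q (C b)) + b \<bullet> Q m)"
    and "0 \<le> b \<bullet> Q (C b)"
proof -
  interpret Q: bounded_linear Q by fact
  have C_sym: "C x \<bullet> y = x \<bullet> C y" and C_pos: "0 \<le> C x \<bullet> x" and C_bdd: "bounded_op_on UNIV C" for x y
    using covariance_op_on_sym[OF cov] covariance_op_on_pos[OF cov] cov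
    by (auto simp: covariance_op_on_def)
  have C_lin: "linear C"
    using C_bdd by (intro linearI) (auto simp: bounded_op_on_def)
  define D where "D x = inv C (Q (C x))" for x
  have D: "D x \<bullet> y = x \<bullet> Q y" for x y
    unfolding D_def by (rule Z_symmetric_adjoint[OF C_bdd C_sym C_pos injC dense Q(1,5) sym])
  have CD: "C (D x) = Q (C x)" for x
    unfolding D_def by (rule f_inv_into_f) (use Q(5) in blast)
  have QQ: "Q (Q x) = Q x" for x
    using Q(2) by (metis comp_apply)
  have H: "x \<in> range Q \<longleftrightarrow> Q x = x" for x
    using QQ by (metis rangeE rangeI)
  have "range Q = {x. Q x = x}" using H by blast
  then have closed: "closed (range Q)"
    by (simp add: closed_Collect_eq Q.continuous_on)
  have subspace: "subspace (range Q)"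
    unfolding Q(4) by (rule subspace_span)
  note K_sym = covariance_op_on_sym[OF covK] and K_pos = covariance_op_on_pos[OF covK]
  have K_bdd: "bounded_op_on (range Q) K"
    using covK by (simp add: covariance_op_on_def)
  \<comment> \<open>Moving \<open>Q\<close> onto the test vectors through its adjoint
    \<open>D\<close> gives \<open>r \<bullet> K s = D r \<bullet> C (D s) = D r \<bullet> Q (C s) =
    r \<bullet> Q (C s)\<close> for \<open>r\<close> in the range of \<open>Q\<close>. The
    difference of both sides lies in that range and is orthogonal to it.\<close>
  have K: "K s = Q (C s)" if s: "s \<in> range Q" for s
  proof -
    have inner: "r \<bullet> K s = r \<bullet> Q (C s)" if r: "r \<in> range Q" for r
    proof -
      have "has_bochner_integral M (\<lambda>\<omega>. (r \<bullet> Q (X \<omega>)) * (Q (X \<omega>) \<bullet> s)) (r \<bullet> K s)"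
        using covK r s unfolding covariance_op_on_def by blast
      moreover have "has_bochner_integral M (\<lambda>\<omega>. (D r \<bullet> X \<omega>) * (X \<omega> \<bullet> D s)) (D r \<bullet> C (D s))"
        using cov unfolding covariance_op_on_def by blast
      moreover have "X \<omega> \<bullet> D s = Q (X \<omega>) \<bullet> s" for \<omega>
        unfolding inner_commute[of "X \<omega>" "D s"] inner_commute[of "Q (X \<omega>)" s] by (rule D)
      ultimately have "r \<bullet> K s = D r \<bullet> C (D s)"
        unfolding D by (intro has_bochner_integral_eq[of M "\<lambda>\<omega>. (r \<bullet> Q (X \<omega>)) * (Q (X \<omega>) \<bullet> s)"]) (simp_all add: D)
      then show ?thesis by (simp add: CD D QQ)
    qed
    have "K s \<in> range Q"
      using K_bdd s unfolding bounded_op_on_def by blast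
    then have "K s - Q (C s) \<in> range Q"
      using subspace by (intro subspace_diff) auto
    from inner[OF this] show ?thesis
      by (metis inner_diff_right inner_eq_zero_iff right_minus_eq)
  qed
  \<comment> \<open>\<open>D\<close> factors through \<open>Q (C s)\<close>, so
    \<open>D s = D t\<close>. Vectors with equal \<open>Q C\<close>-values thus have equal products
    with the whole range of \<open>Q\<close>. This yields injectivity below and later allows
    \<open>s\<close> to be traded for \<open>b\<close>.\<close>
  have D_eq: "s \<bullet> Q y = t \<bullet> Q y" if "Q (C s) = Q (C t)" for s t y
    using that by (simp flip: D add: D_def)
  have inj: "inj_on (\<lambda>x. Q (C x)) (range Q)"
  proof (rule inj_onI)
    fix s t assume st: "s \<in> range Q" "t \<in> range Q" "Q (C s) = Q (C t)"
    have "Q (s - t) = s - t"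
      using st(1,2) H Q.diff by simp
    with D_eq[OF st(3), of "s - t"] have "(s - t) \<bullet> (s - t) = 0"
      by (simp add: inner_diff_left)
    then show "s = t" by simp
  qed
  then have inj_K: "inj_on K (range Q)"
    by (rule inj_on_cong[THEN iffD1, rotated]) (simp add: K)
  have "linear (\<lambda>x. Q (C x))"
    using linear_compose[OF C_lin Q.linear] by (simp add: o_def)
  \<comment> \<open>Finite dimension turns injectivity into surjectivity, which supplies the
    preimage \<open>s\<close> of \<open>Q (C b)\<close> inside the range of
    \<open>Q\<close>.\<close>
  then have "(\<lambda>x. Q (C x)) ` span B = span B"
    using inj by (intro linear_inj_on_span_surj Q(3)) (auto simp flip: Q(4))
  then obtain s where s: "s \<in> range Q" "Q (C s) = Q (C b)"
    by (metis (no_types, lifting) Q(4) imageE rangeI)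
  have "recon_weight (range Q) K F (Q m) v = exp (- (1/2) * (s \<bullet> F v) + s \<bullet> Q m)"
    by (rule recon_weight_eq[OF subspace closed K_bdd K_sym K_pos inj_K s(1)])
      (simp_all add: F K s)
  then show "recon_weight (range Q) K F (Q m) v = exp (- (1/2) * (b \<bullet> Q (C b)) + b \<bullet> Q m)"
    using D_eq[OF s(2)] by (simp add: F)
  have "b \<bullet> Q (C b) = s \<bullet> K s"
    using D_eq[OF s(2)] by (simp add: K s)
  then show "0 \<le> b \<bullet> Q (C b)"
    using K_pos[OF s(1)] by (simp add: inner_commute)
qed

subsection \<open>Limits of reconstructors\<close>

text \<open>The weight free of inverses, with \<open>B\<close> in the role of \<open>C^-1 A\<close>.
  Taking \<open>Q\<close> as the identity gives the weight of the unprojected model, so one family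
  covers both models.\<close>

definition tilted_weight ::
  "('y \<Rightarrow> 's::real_inner) \<Rightarrow> ('y \<Rightarrow> 's) \<Rightarrow> ('s \<Rightarrow> 's) \<Rightarrow> 's \<Rightarrow> 'y \<Rightarrow> real" where
  "tilted_weight B A Q m v = exp (- (1/2) * (B v \<bullet> Q (A v)) + B v \<bullet> Q m)"

text \<open>The reconstructor pulled back to the probability space, so that the varying priors
  become varying integrands over one fixed measure.\<close>

definition tilted_mean ::
  "'w measure \<Rightarrow> ('y \<Rightarrow> real) \<Rightarrow> ('y \<Rightarrow> real) \<Rightarrow> ('w \<Rightarrow> 'y) \<Rightarrow> real" where
  "tilted_mean M g w X = (\<integral>\<omega>. g (X \<omega>) * w (X \<omega>) \<partial>M) / (\<integral>\<omega>. w (X \<omega>) \<partial>M)"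

lemma reconstructor_eq_tilted_mean:
  fixes w :: "'y::topological_space \<Rightarrow> real"
  assumes "\<And>v. recon_weight H K F m v = w v" and "X \<in> borel_measurable M"
    and "g \<in> borel_measurable borel" "w \<in> borel_measurable borel"
  shows "reconstructor H K F (distr M borel X) g m = tilted_mean M g w X"
  using assms by (simp add: reconstructor_def tilted_mean_def integral_distr)

lemma continuous_tilted_weight:
  fixes B A :: "'y::real_normed_vector \<Rightarrow> 's::real_inner"
  assumes "bounded_linear B" "bounded_linear A" "bounded_linear Q"
  shows "continuous_on UNIV (tilted_weight B A Q m)"
  unfolding tilted_weight_def
  by (intro continuous_intros bounded_linear.continuous_on[OF assms(1)]
      bounded_linear.continuous_on[OF assms(2)] bounded_linear.continuous_on[OF assms(3)])

text \<open>Dominated convergence in numerator and denominator. Both \<open>Qs\<close> and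
  \<open>Xs\<close> may vary, and either may be constant, so the joint limit and both partial limits
  are instances.\<close>

lemma tilted_mean_tendsto:
  fixes B A :: "'y::{banach, second_countable_topology} \<Rightarrow> 's::real_inner"
    and Qs :: "nat \<Rightarrow> 's \<Rightarrow> 's" and Xs :: "nat \<Rightarrow> 'w \<Rightarrow> 'y"
  assumes "prob_space M"
    and exp_moments: "\<forall>l>0. integrable M (\<lambda>\<omega>. exp (l * norm (U \<omega>)))"
    and g: "continuous_on UNIV g" "\<forall>v. \<bar>g v\<bar> \<le> a * exp (a * norm v)"
    and B: "bounded_linear B" and A: "bounded_linear A"
    and Q: "bounded_linear Q" "\<And>j. bounded_linear (Qs j)" "\<And>j v. 0 \<le> B v \<bullet> Qs j (A v)"
    and X: "X \<in> borel_measurable M" "\<And>j. Xs j \<in> borel_measurable M"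
    and Xs_le: "\<And>j \<omega>. norm (Xs j \<omega>) \<le> c * norm (U \<omega>)" and c: "0 < c"
    and lim_X: "\<And>\<omega>. (\<lambda>j. Xs j \<omega>) \<longlonglongrightarrow> X \<omega>"
    and lim_QA: "\<And>\<omega>. (\<lambda>j. Qs j (A (Xs j \<omega>))) \<longlonglongrightarrow> Q (A (X \<omega>))"
    and lim_Qm: "(\<lambda>j. Qs j m) \<longlonglongrightarrow> Q m"
  shows "(\<lambda>j. tilted_mean M g (tilted_weight B A (Qs j) m) (Xs j))
    \<longlonglongrightarrow> tilted_mean M g (tilted_weight B A Q m) X"
proof -
  interpret prob_space M by fact
  define w where "w = tilted_weight B A Q m"
  define ws where "ws j = tilted_weight B A (Qs j) m" for j
  have cont: "continuous_on UNIV w" "continuous_on UNIV (ws j)" for j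
    unfolding w_def ws_def by (intro continuous_tilted_weight B A Q)+
  have [measurable]: "g \<in> borel_measurable borel" "w \<in> borel_measurable borel" "ws j \<in> borel_measurable borel" for j
    using cont g by (auto intro: borel_measurable_continuous_onI)
  note [measurable] = X
  have a: "0 \<le> a"
    using g(2)[rule_format, of 0] by simp
  obtain b where b: "0 < b" "\<And>v. norm (B v) \<le> norm v * b"
    using bounded_linear.pos_bounded[OF B] by blast
  obtain d where d: "0 < d" "\<And>j. norm (Qs j m) \<le> d"
    using Bseq_def[of "\<lambda>j. Qs j m"] convergent_imp_Bseq[OF convergentI[OF lim_Qm]] by auto
  \<comment> \<open>The quadratic term only decreases the weight. The linear term is at most
    \<open>norm (B (Xs j \<omega>)) * norm (Qs j m)\<close>, where the first factor is bounded by
    \<open>b * c * norm (U \<omega>)\<close> and the second by \<open>d\<close>, a bound for the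
    convergent sequence.\<close>
  define l where "l = b * c * d"
  have l: "0 < l" using b d c by (simp add: l_def)
  have ws_le: "ws j (Xs j \<omega>) \<le> exp (l * norm (U \<omega>))" for j \<omega>
  proof -
    have "B (Xs j \<omega>) \<bullet> Qs j m \<le> norm (B (Xs j \<omega>)) * norm (Qs j m)"
      by (rule norm_cauchy_schwarz)
    also have "\<dots> \<le> (c * norm (U \<omega>) * b) * d"
      using order_trans[OF b(2) mult_right_mono[OF Xs_le[of j \<omega>], of b]] b(1) c
      by (intro mult_mono d) auto
    finally show ?thesis
      using Q(3)[of "Xs j \<omega>" j] by (simp add: ws_def tilted_weight_def l_def algebra_simps)
  qed
  have ws_nonneg: "0 \<le> ws j v" and w_pos: "0 < w v" for j v
    by (simp_all add: ws_def w_def tilted_weight_def)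
  have g_le: "\<bar>g (Xs j \<omega>)\<bar> \<le> a * exp (a * c * norm (U \<omega>))" for j \<omega>
  proof -
    have "a * norm (Xs j \<omega>) \<le> a * c * norm (U \<omega>)"
      using mult_left_mono[OF Xs_le a] by (simp add: mult.assoc)
    then show ?thesis
      using g(2)[rule_format, of "Xs j \<omega>"] a by (meson exp_le_cancel_iff mult_left_mono order_trans)
  qed
  have lim_w: "(\<lambda>j. ws j (Xs j \<omega>)) \<longlonglongrightarrow> w (X \<omega>)" for \<omega>
    unfolding w_def ws_def tilted_weight_def
    by (intro tendsto_intros lim_QA lim_Qm bounded_linear.tendsto[OF B] lim_X)
  have lim_g: "(\<lambda>j. g (Xs j \<omega>)) \<longlonglongrightarrow> g (X \<omega>)" for \<omega>
    using g(1) lim_X by (rule continuous_on_tendsto_compose) auto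
  have int_w: "integrable M (\<lambda>\<omega>. w (X \<omega>))"
    and lim_den: "(\<lambda>j. \<integral>\<omega>. ws j (Xs j \<omega>) \<partial>M) \<longlonglongrightarrow> (\<integral>\<omega>. w (X \<omega>) \<partial>M)"
  proof -
    have 1: "integrable M (\<lambda>\<omega>. exp (l * norm (U \<omega>)))" using exp_moments l by blast
    have 2: "AE \<omega> in M. (\<lambda>j. ws j (Xs j \<omega>)) \<longlonglongrightarrow> w (X \<omega>)" using lim_w by simp
    have 3: "AE \<omega> in M. norm (ws j (Xs j \<omega>)) \<le> exp (l * norm (U \<omega>))" for j
      using ws_le ws_nonneg by simp
    show "integrable M (\<lambda>\<omega>. w (X \<omega>))"
      by (rule integrable_dominated_convergence[OF _ _ 1 2 3]) measurable
    show "(\<lambda>j. \<integral>\<omega>. ws j (Xs j \<omega>) \<partial>M) \<longlonglongrightarrow> (\<integral>\<omega>. w (X \<omega>) \<partial>M)"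
      by (rule integral_dominated_convergence[OF _ _ 1 2 3]) measurable
  qed
  have lim_num: "(\<lambda>j. \<integral>\<omega>. g (Xs j \<omega>) * ws j (Xs j \<omega>) \<partial>M) \<longlonglongrightarrow> (\<integral>\<omega>. g (X \<omega>) * w (X \<omega>) \<partial>M)"
  proof (rule integral_dominated_convergence[where w = "\<lambda>\<omega>. a * exp ((a * c + l) * norm (U \<omega>))"])
    have "0 < a * c + l" using a c l by (simp add: add_nonneg_pos)
    then show "integrable M (\<lambda>\<omega>. a * exp ((a * c + l) * norm (U \<omega>)))"
      using exp_moments by (intro integrable_mult_right) simp
    show "AE \<omega> in M. (\<lambda>j. g (Xs j \<omega>) * ws j (Xs j \<omega>)) \<longlonglongrightarrow> g (X \<omega>) * w (X \<omega>)"
      by (intro AE_I2 tendsto_mult lim_g lim_w)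
    show "AE \<omega> in M. norm (g (Xs j \<omega>) * ws j (Xs j \<omega>)) \<le> a * exp ((a * c + l) * norm (U \<omega>))" for j
    proof (rule AE_I2)
      fix \<omega>
      have "norm (g (Xs j \<omega>) * ws j (Xs j \<omega>)) \<le> (a * exp (a * c * norm (U \<omega>))) * exp (l * norm (U \<omega>))"
        using g_le[of j \<omega>] ws_le[of j \<omega>] ws_nonneg[of j "Xs j \<omega>"] a
        by (simp add: abs_mult mult_mono)
      then show "norm (g (Xs j \<omega>) * ws j (Xs j \<omega>)) \<le> a * exp ((a * c + l) * norm (U \<omega>))"
        by (simp add: mult.assoc distrib_right flip: exp_add)
    qed
  qed measurable
  \<comment> \<open>The limit of the denominators is the integral of a strictly positive function
    against a probability measure, so the quotients converge.\<close>
  have "(\<integral>\<omega>. w (X \<omega>) \<partial>M) \<noteq> 0"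
  proof
    assume "(\<integral>\<omega>. w (X \<omega>) \<partial>M) = 0"
    then have "AE \<omega> in M. w (X \<omega>) = 0"
      using int_w w_pos by (subst (asm) integral_nonneg_eq_0_iff_AE) (auto intro: less_imp_le)
    then have "AE \<omega> in M. False"
      by eventually_elim (use w_pos in \<open>simp add: less_imp_neq[symmetric]\<close>)
    then show False by simp
  qed
  then show ?thesis
    unfolding tilted_mean_def w_def[symmetric] ws_def[symmetric]
    by (rule tendsto_divide[OF lim_num lim_den])
qed

text \<open>If the joint limit failed, indices \<open>n i\<close> and \<open>k i\<close>, both at
  least \<open>i\<close>, could be chosen with values staying away from \<open>L\<close>; these
  index sequences tend to infinity. This brings double limits within reach of dominated convergence
  along sequences.\<close>

lemma tendsto_prod_sequentiallyI:
  fixes f :: "nat \<Rightarrow> nat \<Rightarrow> 'a::metric_space"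
  assumes "\<And>n k. filterlim n at_top sequentially \<Longrightarrow> filterlim k at_top sequentially \<Longrightarrow>
    (\<lambda>i. f (n i) (k i)) \<longlonglongrightarrow> L"
  shows "((\<lambda>(n, k). f n k) \<longlongrightarrow> L) (sequentially \<times>\<^sub>F sequentially)"
proof (rule tendstoI, rule ccontr)
  fix e :: real
  assume e: "0 < e"
    and "\<not> (\<forall>\<^sub>F p in sequentially \<times>\<^sub>F sequentially. dist (case p of (n, k) \<Rightarrow> f n k) L < e)"
  then have "\<forall>i. \<exists>n k. i \<le> n \<and> i \<le> k \<and> \<not> dist (f n k) L < e"
    unfolding eventually_prod_sequentially by fastforce
  then obtain n k where nk: "\<And>i. i \<le> n i" "\<And>i. i \<le> k i" "\<And>i. \<not> dist (f (n i) (k i)) L < e"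
    by metis
  have "filterlim n at_top sequentially" "filterlim k at_top sequentially"
    using nk(1,2) by (auto intro: filterlim_at_top_mono[OF filterlim_ident])
  then have "(\<lambda>i. f (n i) (k i)) \<longlonglongrightarrow> L"
    by (rule assms)
  then have "\<forall>\<^sub>F i in sequentially. dist (f (n i) (k i)) L < e"
    using e by (rule tendstoD)
  then show False
    using nk(3) by simp
qed

section \<open>The joint and the partial limits of the reconstructors\<close>

theorem theorem7:
  fixes M :: "'w measure"
    and U :: "'w \<Rightarrow> 'y::{banach, second_countable_topology}"
    and \<E> :: "'w \<Rightarrow> 's::{real_inner, banach, second_countable_topology}"
    and C :: "'s \<Rightarrow> 's"
    and A :: "'y \<Rightarrow> 's"
    and g :: "'y \<Rightarrow> real"
    and a C0 :: real
    and T :: "nat \<Rightarrow> 'y \<Rightarrow> 'y"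
    and P :: "nat \<Rightarrow> 's \<Rightarrow> 's"
    and Ck :: "nat \<Rightarrow> 's \<Rightarrow> 's"
    and R :: "nat \<Rightarrow> nat \<Rightarrow> real"
    and \<omega>0 :: 'w and u :: 'y and \<epsilon> m :: 's and mk :: "nat \<Rightarrow> 's"
  assumes prob: "prob_space M" and complete: "complete_measure M"
    and U_rv: "U \<in> borel_measurable M"
    and gauss: "gaussian_rv M \<E>"
    and indep: "prob_space.indep_set M {U -` B \<inter> space M | B. B \<in> sets borel}
                                       {\<E> -` B \<inter> space M | B. B \<in> sets borel}"
    and mean: "has_bochner_integral M \<E> 0"
    and cov: "covariance_op_on M UNIV \<E> C"
    and ess_dense: "closure (essential_range M \<E>) = UNIV"
    and A_lin: "linear A" and A_range: "range A \<subseteq> S1_space C"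
    and A_bdd: "\<exists>B. \<forall>y. S1_norm C (A y) \<le> B * norm y"
    and exp_moments: "\<forall>l>0. integrable M (\<lambda>\<omega>. exp (l * norm (U \<omega>)))"
    and g_cont: "continuous_on UNIV g"
    and g_growth: "\<forall>v. \<bar>g v\<bar> \<le> a * exp (a * norm v)"
    and T_lin: "\<forall>n. bounded_linear (T n)" and T_proj: "\<forall>n. T n \<circ> T n = T n"
    and P_lin: "\<forall>k. bounded_linear (P k)" and P_proj: "\<forall>k. P k \<circ> P k = P k"
    and P_fin: "\<forall>k. \<exists>B. finite B \<and> range (P k) = span B"
    and P_range: "\<forall>k. range (P k) \<subseteq> S1_space C"
    and P_sym: "\<forall>k. \<forall>\<phi>\<in>Z_space C. \<forall>\<psi>\<in>Z_space C. Z_inner C (P k \<phi>) \<psi> = Z_inner C \<phi> (P k \<psi>)"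
    and T_conv: "\<forall>y. (\<lambda>n. norm (T n y - y)) \<longlonglongrightarrow> 0"
    and P_conv_S1: "\<forall>z\<in>range A. (\<lambda>k. S1_norm C (P k z - z)) \<longlonglongrightarrow> 0"
    and P_conv_S: "\<forall>z. (\<lambda>k. norm (P k z - z)) \<longlonglongrightarrow> 0"
    and C0_pos: "0 < C0"
    and T_norm: "\<forall>n. onorm (T n) \<le> C0"
    and P_norm: "\<forall>k. \<forall>z\<in>S1_space C. S1_norm C (P k z) \<le> C0 * S1_norm C z"
    and Ck_cov: "\<forall>k. covariance_op_on M (range (P k)) (\<lambda>\<omega>. P k (\<E> \<omega>)) (Ck k)"
    and omega0: "\<omega>0 \<in> space M" and u_def: "u = U \<omega>0" and eps_def: "\<epsilon> = \<E> \<omega>0"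
    and m_def: "m = A u + \<epsilon>" and mk_def: "\<forall>k. mk k = P k (A u) + P k \<epsilon>"
    and R_def: "\<forall>n k. R n k = reconstructor (range (P k)) (Ck k) (\<lambda>v. P k (A v))
                        (distr M borel (\<lambda>\<omega>. T n (U \<omega>))) g (mk k)"
  shows "((\<lambda>(n, k). R n k) \<longlongrightarrow> reconstructor UNIV C A (distr M borel U) g m)
           (sequentially \<times>\<^sub>F sequentially)
       \<and> (\<forall>k. convergent (\<lambda>n. R n k))
       \<and> (\<forall>n. convergent (\<lambda>k. R n k))"
proof -
  interpret prob_space M by fact
  note [measurable] = U_rv
  have injC: "inj C"
    by (rule covariance_op_inj[OF cov _ ess_dense]) (use gauss in \<open>auto simp: gaussian_rv_def finite_measure_axioms\<close>)
  have C_bdd: "bounded_op_on UNIV C"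
    using cov by (simp add: covariance_op_on_def)
  then obtain \<kappa> where "\<And>x. norm (C x) \<le> \<kappa> * norm x"
    unfolding bounded_op_on_def by blast
  with C_bdd have C: "bounded_linear C"
    by (intro bounded_linear_intro[where K = \<kappa>]) (auto simp: bounded_op_on_def mult.commute)
  interpret C: bounded_linear C by (rule C)
  \<comment> \<open>The projections themselves provide the approximants: \<open>P k z\<close> lies
    in \<open>range C\<close> and tends to \<open>z\<close>.\<close>
  have dense: "closure (range C) = UNIV"
  proof (rule UNIV_eq_I[symmetric])
    fix z
    have "(\<lambda>k. P k z) \<longlonglongrightarrow> z"
      using P_conv_S by (simp add: tendsto_norm_zero_iff LIM_zero_iff)
    moreover have "P k z \<in> range C" for k
      using P_range unfolding S1_space_def by blast
    ultimately show "z \<in> closure (range C)"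
      by (intro closure_sequential[THEN iffD2] exI[of _ "\<lambda>k. P k z"]) simp
  qed
  \<comment> \<open>Boundedness of \<open>A\<close> into the space \<open>C S\<close> with the
    transported norm is exactly boundedness of \<open>B\<close> into the ambient space.\<close>
  define B where "B v = inv C (A v)" for v
  have CB: "C (B v) = A v" for v
    unfolding B_def using A_range by (intro f_inv_into_f) (auto simp: S1_space_def)
  obtain \<beta> where \<beta>: "\<And>v. norm (B v) \<le> \<beta> * norm v"
    using A_bdd by (auto simp: S1_norm_def B_def)
  have B: "bounded_linear B"
  proof (rule bounded_linear_intro)
    show "B (x + y) = B x + B y" for x y
      by (rule injD[OF injC]) (simp add: CB C.add linear_add[OF A_lin])
    show "B (r *\<^sub>R x) = r *\<^sub>R B x" for r x
      by (rule injD[OF injC]) (simp add: CB C.scaleR linear_scale[OF A_lin])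
    show "norm (B x) \<le> norm x * \<beta>" for x
      using \<beta> by (simp add: mult.commute)
  qed
  have A: "bounded_linear A"
    using bounded_linear_compose[OF C B] by (simp add: CB)
  interpret A: bounded_linear A by (rule A)
  obtain \<gamma> where \<gamma>: "0 < \<gamma>" "\<And>x. norm (C x) \<le> norm x * \<gamma>"
    using C.pos_bounded by blast
  \<comment> \<open>A bound uniform in \<open>k\<close>: \<open>P k\<close> is uniformly bounded in
    the norm transported by \<open>C\<close>, in which \<open>A\<close> takes bounded values, and
    \<gamma> is the constant of the embedding into the ambient space.\<close>
  have PA_le: "norm (P k (A v)) \<le> \<gamma> * C0 * \<beta> * norm v" for k v
  proof -
    have mem: "P k (A v) \<in> range C"
      using P_range unfolding S1_space_def by blast
    have "norm (P k (A v)) \<le> \<gamma> * S1_norm C (P k (A v))"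
      using \<gamma>(2)[of "inv C (P k (A v))"] f_inv_into_f[OF mem] by (simp add: S1_norm_def mult.commute)
    also have "S1_norm C (P k (A v)) \<le> C0 * S1_norm C (A v)"
      using P_norm A_range by blast
    also have "S1_norm C (A v) \<le> \<beta> * norm v"
      using \<beta> by (simp add: S1_norm_def B_def)
    finally show ?thesis
      using \<gamma> C0_pos by (simp add: mult.assoc)
  qed
  \<comment> \<open>Splitting \<open>x j\<close> as \<open>(x j - x0) + x0\<close>: the uniform
    bound controls the first part, strong convergence of the projections the second.\<close>
  have lim_P: "(\<lambda>j. P (k j) (A (x j))) \<longlonglongrightarrow> A x0"
    if x: "x \<longlonglongrightarrow> x0" and k: "filterlim k at_top sequentially" for x x0 k
  proof -
    have "(\<lambda>j. P (k j) (A (x j - x0))) \<longlonglongrightarrow> 0"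
    proof (rule Lim_null_comparison)
      show "\<forall>\<^sub>F j in sequentially. norm (P (k j) (A (x j - x0))) \<le> \<gamma> * C0 * \<beta> * norm (x j - x0)"
        using PA_le by simp
      show "(\<lambda>j. \<gamma> * C0 * \<beta> * norm (x j - x0)) \<longlonglongrightarrow> 0"
        using x by (intro tendsto_mult_right_zero) (simp add: tendsto_norm_zero_iff LIM_zero_iff)
    qed
    moreover have "(\<lambda>j. P j (A x0)) \<longlonglongrightarrow> A x0"
      using P_conv_S by (simp add: tendsto_norm_zero_iff LIM_zero_iff)
    then have "(\<lambda>j. P (k j) (A x0)) \<longlonglongrightarrow> A x0"
      using k by (rule filterlim_compose)
    ultimately have "(\<lambda>j. P (k j) (A (x j - x0)) + P (k j) (A x0)) \<longlonglongrightarrow> 0 + A x0"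
      by (rule tendsto_add)
    then show ?thesis
      using P_lin by (simp add: A.diff linear_diff bounded_linear.linear)
  qed
  have lim_Pm: "(\<lambda>j. P (k j) m) \<longlonglongrightarrow> m" if "filterlim k at_top sequentially" for k
  proof -
    have "(\<lambda>j. P j m) \<longlonglongrightarrow> m"
      using P_conv_S by (simp add: tendsto_norm_zero_iff LIM_zero_iff)
    then show ?thesis using that by (rule filterlim_compose)
  qed
  have T_le: "norm (T n x) \<le> C0 * norm x" for n x
    using onorm[of "T n" x] T_lin T_norm mult_right_mono[of "onorm (T n)" C0 "norm x"]
    by (meson norm_ge_zero order_trans)
  have lim_T: "(\<lambda>j. T (n j) x) \<longlonglongrightarrow> x" if "filterlim n at_top sequentially" for n x
  proof -
    have "(\<lambda>j. T j x) \<longlonglongrightarrow> x"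
      using T_conv by (simp add: tendsto_norm_zero_iff LIM_zero_iff)
    then show ?thesis using that by (rule filterlim_compose)
  qed
  have [measurable]: "T n \<in> borel_measurable borel" for n
    using T_lin by (simp add: borel_measurable_continuous_onI linear_continuous_on)
  have [measurable]: "g \<in> borel_measurable borel"
    using g_cont by (rule borel_measurable_continuous_onI)
  let ?w = "tilted_weight B A"
  have [measurable]: "?w Q m \<in> borel_measurable borel" if "bounded_linear Q" for Q
    using that by (intro borel_measurable_continuous_onI continuous_tilted_weight A B)
  have weight_k: "recon_weight (range (P k)) (Ck k) (\<lambda>v. P k (A v)) (mk k) v = ?w (P k) m v"
    and pos_k: "0 \<le> B v \<bullet> P k (A v)" for k v
  proof -
    obtain b where b: "finite b" "range (P k) = span b" using P_fin by blast
    have mk: "mk k = P k m"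
      using P_lin by (simp add: mk_def m_def linear_add bounded_linear.linear)
    note pw = projected_recon_weight[where Q = "P k" and K = "Ck k" and b = "B v" and v = v
        and F = "\<lambda>v. P k (A v)", OF cov injC dense P_lin[THEN spec] P_proj[THEN spec] b
        P_range[THEN spec, unfolded S1_space_def] P_sym[THEN spec] Ck_cov[THEN spec]]
    show "recon_weight (range (P k)) (Ck k) (\<lambda>v. P k (A v)) (mk k) v = ?w (P k) m v"
      using pw(1)[of m] by (simp add: mk CB tilted_weight_def)
    show "0 \<le> B v \<bullet> P k (A v)"
      using pw(2) by (simp add: CB)
  qed
  \<comment> \<open>For the full model the preimage of \<open>A v\<close> under \<open>C\<close> is
    \<open>B v\<close> itself, so the projection is the identity.\<close>
  have weight: "recon_weight UNIV C A m v = ?w (\<lambda>x. x) m v" for v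
    using recon_weight_eq[of UNIV C "B v" A v m] C_bdd injC
      covariance_op_on_sym[OF cov] covariance_op_on_pos[OF cov]
    by (simp add: CB tilted_weight_def)
  have R: "R n k = tilted_mean M g (?w (P k) m) (\<lambda>\<omega>. T n (U \<omega>))" for n k
    unfolding R_def[rule_format]
    by (rule reconstructor_eq_tilted_mean) (use weight_k P_lin in \<open>auto\<close>)
  have R_lim: "reconstructor UNIV C A (distr M borel U) g m = tilted_mean M g (?w (\<lambda>x. x) m) U"
    by (rule reconstructor_eq_tilted_mean) (auto simp: weight bounded_linear_ident)
  note lim = tilted_mean_tendsto[OF prob exp_moments g_cont g_growth B A, where c = C0]
  have "((\<lambda>(n, k). R n k) \<longlongrightarrow> reconstructor UNIV C A (distr M borel U) g m)
    (sequentially \<times>\<^sub>F sequentially)"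
    unfolding R_lim
  proof (rule tendsto_prod_sequentiallyI)
    fix n k :: "nat \<Rightarrow> nat"
    assume nk: "filterlim n at_top sequentially" "filterlim k at_top sequentially"
    show "(\<lambda>i. R (n i) (k i)) \<longlonglongrightarrow> tilted_mean M g (?w (\<lambda>x. x) m) U"
      unfolding R
      by (rule lim) (use P_lin nk in \<open>auto intro: pos_k T_le C0_pos lim_T lim_P lim_Pm bounded_linear_ident\<close>)
  qed
  \<comment> \<open>Here \<open>Qs\<close> is constantly \<open>P k\<close>; the limit keeps the
    projected weight and replaces \<open>T n (U \<omega>)\<close> by
    \<open>U \<omega>\<close>.\<close>
  moreover have "convergent (\<lambda>n. R n k)" for k
  proof (rule convergentI)
    have PAT: "(\<lambda>n. P k (A (T n x))) \<longlonglongrightarrow> P k (A x)" for x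
      using lim_T[OF filterlim_ident, of x] by (intro bounded_linear.tendsto[of "P k"] A.tendsto) (simp_all add: P_lin)
    show "(\<lambda>n. R n k) \<longlonglongrightarrow> tilted_mean M g (?w (P k) m) U"
      unfolding R
      by (rule lim) (use P_lin lim_T[OF filterlim_ident] in \<open>auto intro: pos_k T_le C0_pos PAT\<close>)
  qed
  \<comment> \<open>Here \<open>Xs\<close> is constant; the limit has the unprojected weight at
    \<open>T n (U \<omega>)\<close>.\<close>
  moreover have "convergent (\<lambda>k. R n k)" for n
  proof (rule convergentI)
    show "(\<lambda>k. R n k) \<longlonglongrightarrow> tilted_mean M g (?w (\<lambda>x. x) m) (\<lambda>\<omega>. T n (U \<omega>))"
      unfolding R
      by (rule lim) (use P_lin lim_P[OF tendsto_const filterlim_ident] lim_Pm[OF filterlim_ident]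
          in \<open>auto intro: pos_k T_le C0_pos bounded_linear_ident\<close>)
  qed
  ultimately show ?thesis by blast
qed

end
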